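(* The monoid $M_2(K^{\infty})$ of $2\times 2$ matrices over the min-plus semiring $K^{\infty}=\mathbb{N}\cup\{\infty\}$ is generated by the matrices $$A_i=\begin{pmatrix} i & 0\\ 0 & \infty\end{pmatrix}\ (i\in\mathbb{N}\cup\{\infty\}),\qquad B=\begin{pmatrix} 1 & \infty\\ \infty & 0\end{pmatrix},\qquad C=\begin{pmatrix} \infty & \infty\\ \infty & 0\end{pmatrix}.$$
   Context: $\mathbb{N}=\{0,1,2,\ldots\}$. The min-plus semiring $K^{\infty}$ is the set $\mathbb{N}\cup\{\infty\}$ with operations $\oplus=\min$ (where $\infty$ is the largest element) and $\otimes=+$, where $x\otimes\infty=\infty\otimes x=\infty$ for all $x\in\mathbb{N}\cup\{\infty\}$. Its multiplicative identity (one) is the number $0$ and its additive identity (zero) is $\infty$. $M_2(K^{\infty})$ is the monoid of all $2\times 2$ matrices with entries in $K^{\infty}$ under matrix multiplication with respect to $\oplus$ and $\otimes$, i.e. $(XY)_{pq}=(X_{p1}\otimes Y_{1q})\oplus(X_{p2}\otimes Y_{2q})$; its identity is $\begin{pmatrix} 0&\infty\\ \infty&0\end{pmatrix}$. The entries $0,1,i$ in the matrices of the claim denote the corresponding natural numbers (or $\infty$), not the zero and one of the semiring. *)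

theory Defs
  imports "HOL-Analysis.Analysis" "HOL-Library.Extended_Nat" "HOL-Algebra.Group"
begin

text \<open>The min-plus semiring on \<open>\<nat> \<union> {\<infinity>}\<close>. It is a copy of \<^typ>\<open>enat\<close>, because \<^typ>\<open>enat\<close> itself
  carries the usual addition and multiplication. Note that the \<open>0\<close> and \<open>1\<close> of type \<open>minplus\<close> are
  \<open>MinPlus \<infinity>\<close> and \<open>MinPlus 0\<close>.\<close>

datatype minplus = MinPlus (val: enat)

instantiation minplus :: comm_semiring_1
begin

definition "0 = MinPlus \<infinity>"
definition "1 = MinPlus 0"
definition "x + y = MinPlus (min (val x) (val y))"
definition "x * y = MinPlus (val x + val y)"

instance
proof
  fix a b c :: minplus
  show "a + b + c = a + (b + c)" by (simp add: plus_minplus_def min.assoc)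
  show "a + b = b + a" by (simp add: plus_minplus_def min.commute)
  show "0 + a = a" by (simp add: plus_minplus_def zero_minplus_def)
  show "a * b * c = a * (b * c)" by (simp add: times_minplus_def add.assoc)
  show "a * b = b * a" by (simp add: times_minplus_def add.commute)
  show "1 * a = a" by (simp add: times_minplus_def one_minplus_def)
  show "(a + b) * c = a * c + b * c"
    by (auto simp: times_minplus_def plus_minplus_def min_def add_right_mono antisym)
  show "0 * a = 0" by (simp add: times_minplus_def zero_minplus_def)
  show "a * 0 = 0" by (simp add: times_minplus_def zero_minplus_def)
  show "(0::minplus) \<noteq> 1" by (simp add: zero_minplus_def one_minplus_def)
qed

end

definition M2 :: "(minplus^2^2) monoid" where
  "M2 = \<lparr>carrier = UNIV, mult = (**), one = mat 1\<rparr>"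

lemma monoid_M2: "monoid M2"
  by (rule monoidI) (simp_all add: M2_def matrix_mul_assoc)

lemma mult_M2:
  "(X \<otimes>\<^bsub>M2\<^esub> Y) $ p $ q =
    MinPlus (min (val (X $ p $ 1) + val (Y $ 1 $ q)) (val (X $ p $ 2) + val (Y $ 2 $ q)))"
  by (simp add: M2_def matrix_matrix_mult_def sum_2 plus_minplus_def times_minplus_def)

text \<open>The matrix with rows \<open>(a, b)\<close> and \<open>(c, d)\<close>; the entries are plain elements of \<open>\<nat> \<union> {\<infinity>}\<close>.\<close>

definition mat2 :: "enat \<Rightarrow> enat \<Rightarrow> enat \<Rightarrow> enat \<Rightarrow> minplus^2^2" where
  "mat2 a b c d = vector [vector [MinPlus a, MinPlus b], vector [MinPlus c, MinPlus d]]"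

lemma one_M2: "\<one>\<^bsub>M2\<^esub> = mat2 0 \<infinity> \<infinity> 0"
  by (simp add: M2_def mat2_def mat_def vec_eq_iff forall_2 zero_minplus_def one_minplus_def)

text \<open>The submonoid generated by \<open>S\<close> is the smallest submonoid containing \<open>S\<close>.\<close>

definition generated_submonoid :: "('a, 'b) monoid_scheme \<Rightarrow> 'a set \<Rightarrow> 'a set" where
  "generated_submonoid G S = (\<lambda>H. submonoid H G) hull S"

lemma submonoid_generated_submonoid:
  assumes "monoid G" "S \<subseteq> carrier G"
  shows "submonoid (generated_submonoid G S) G"
proof -
  have "submonoid (carrier G) G"
    by (rule submonoid.intro) (simp_all add: monoid.m_closed[OF assms(1)] monoid.one_closed[OF assms(1)])
  with assms(2) have sub: "generated_submonoid G S \<subseteq> carrier G"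
    unfolding generated_submonoid_def by (rule hull_minimal)
  show ?thesis
    by (rule submonoid.intro)
      (use sub in \<open>auto simp: generated_submonoid_def hull_def
        intro: submonoid.m_closed submonoid.one_closed\<close>)
qed

definition generated_by :: "('a, 'b) monoid_scheme \<Rightarrow> 'a set \<Rightarrow> bool" where
  "generated_by G S \<longleftrightarrow> S \<subseteq> carrier G \<and> generated_submonoid G S = carrier G"

definition matA :: "enat \<Rightarrow> minplus^2^2" where
  "matA i = mat2 i 0 0 \<infinity>"

definition matB :: "minplus^2^2" where
  "matB = mat2 1 \<infinity> \<infinity> 0"

definition matC :: "minplus^2^2" where
  "matC = mat2 \<infinity> \<infinity> \<infinity> 0"

end

theory Submission
  imports Defs
begin

text \<open>
  The proof is Gaussian elimination over the min-plus semiring, in which \<^term>\<open>mat2 x \<infinity> \<infinity> y\<close> is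
  the diagonal matrix with entries \<open>x\<close> and \<open>y\<close>, and \<^term>\<open>matA \<infinity>\<close> is the permutation matrix \<open>P\<close>
  that swaps the two coordinates. Zeros of a matrix below are entries equal to the number \<open>0\<close>,
  which is the one of the semiring. Let \<open>H\<close> be a submonoid that contains the given matrices.

  Since \<open>P\<close> lies in \<open>H\<close>, membership in \<open>H\<close> is invariant under swapping rows and swapping columns.
  Powers of \<^const>\<open>matB\<close>, together with \<^const>\<open>matC\<close> and these swaps, give all diagonal matrices, so
  \<open>H\<close> is also closed under rescaling rows and columns. A column swap turns \<^term>\<open>matA i\<close> into a
  unitriangular matrix, and the product of an upper and a lower unitriangular matrix has zeros on
  the diagonal and arbitrary entries elsewhere (\<open>zero_diagonal_mem\<close>).

  These suffice because \<open>x \<le> y\<close> means that \<open>y = x + t\<close> for some \<open>t\<close>, even if \<open>x\<close> is infinite: the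
  smaller entry of each row can be factored out and becomes \<open>0\<close>. If the two zeros lie in different
  columns, the remaining matrix is, up to a swap, one with zero diagonal. If they lie in the same
  column, the minimum of the other column is factored out in the same way, which leaves three
  zeros, and hence again a matrix with zero diagonal up to a swap.
\<close>

lemma mat2_nth [simp]:
  "mat2 a b c d $ 1 $ 1 = MinPlus a" "mat2 a b c d $ 1 $ 2 = MinPlus b"
  "mat2 a b c d $ 2 $ 1 = MinPlus c" "mat2 a b c d $ 2 $ 2 = MinPlus d"
  by (simp_all add: mat2_def)

lemma mat2_exhaust: obtains a b c d where "X = mat2 a b c d"
proof
  show "X = mat2 (val (X$1$1)) (val (X$1$2)) (val (X$2$1)) (val (X$2$2))"
    by (simp add: vec_eq_iff forall_2)
qed

lemma mult_mat2:
  "mat2 a b c d \<otimes>\<^bsub>M2\<^esub> mat2 a' b' c' d' =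
    mat2 (min (a + a') (b + c')) (min (a + b') (b + d'))
         (min (c + a') (d + c')) (min (c + b') (d + d'))"
  by (simp add: vec_eq_iff forall_2 mult_M2)

context
  fixes H :: "(minplus^2^2) set"
  assumes submonoid_H: "submonoid H M2"
    and generators_H: "range matA \<union> {matB, matC} \<subseteq> H"
begin

lemma mult_mem:
  assumes "mat2 a b c d \<in> H" "mat2 a' b' c' d' \<in> H"
  shows "mat2 (min (a + a') (b + c')) (min (a + b') (b + d'))
              (min (c + a') (d + c')) (min (c + b') (d + d')) \<in> H"
  using submonoid.m_closed[OF submonoid_H assms] by (simp add: mult_mat2)

lemma matA_mem: "mat2 i 0 0 \<infinity> \<in> H"
  using generators_H by (auto simp: matA_def)

lemma swap_rows: "mat2 a b c d \<in> H \<Longrightarrow> mat2 c d a b \<in> H"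
  using mult_mem[OF matA_mem[of \<infinity>], of a b c d] by simp

lemma swap_columns: "mat2 a b c d \<in> H \<Longrightarrow> mat2 b a d c \<in> H"
  using mult_mem[OF _ matA_mem[of \<infinity>], of a b c d] by simp

lemma diagonal_mem: "mat2 x \<infinity> \<infinity> y \<in> H"
proof -
  have left: "mat2 z \<infinity> \<infinity> 0 \<in> H" for z
  proof (cases z)
    case (enat n)
    have "mat2 (enat n) \<infinity> \<infinity> 0 \<in> H"
    proof (induction n)
      case 0
      show ?case
        using submonoid.one_closed[OF submonoid_H] by (simp add: one_M2 zero_enat_def)
    next
      case (Suc n)
      have "mat2 1 \<infinity> \<infinity> 0 \<in> H"
        using generators_H by (simp add: matB_def)
      from mult_mem[OF this Suc] show ?case
        by (simp add: one_enat_def)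
    qed
    then show ?thesis by (simp add: enat)
  next
    case infinity
    then show ?thesis using generators_H by (simp add: matC_def)
  qed
  have "mat2 0 \<infinity> \<infinity> y \<in> H"
    by (rule swap_rows[OF swap_columns[OF left]])
  from mult_mem[OF left[of x] this] show ?thesis by simp
qed

lemma scale_rows: "mat2 a b c d \<in> H \<Longrightarrow> mat2 (x + a) (x + b) (y + c) (y + d) \<in> H"
  using mult_mem[OF diagonal_mem[of x y], of a b c d] by simp

lemma scale_columns: "mat2 a b c d \<in> H \<Longrightarrow> mat2 (a + x) (b + y) (c + x) (d + y) \<in> H"
  using mult_mem[OF _ diagonal_mem[of x y], of a b c d] by simp

text \<open>Exchanging the columns, respectively the rows, of \<^term>\<open>matA i\<close> gives the upper, respectively
  the lower, unitriangular matrices. In their product, the entry \<open>min 0 (i + j)\<close> collapses to \<open>0\<close>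
  because there are no negative entries.\<close>

lemma zero_diagonal_mem: "mat2 0 i j 0 \<in> H"
  using mult_mem[OF swap_columns[OF matA_mem[of i]] swap_rows[OF matA_mem[of j]]] by simp

text \<open>Factoring the minimum out of the second column leaves a matrix with three zeros, in which
  one can always find two of them on a diagonal.\<close>

lemma zero_column_mem: "mat2 0 s 0 t \<in> H"
proof -
  have ordered: "mat2 0 p 0 q \<in> H" if pq: "p \<le> q" for p q
  proof -
    obtain u where q: "q = p + u" using pq le_iff_add by blast
    have "mat2 0 0 0 u \<in> H" by (rule swap_rows[OF zero_diagonal_mem])
    from scale_columns[OF this, of 0 p] show ?thesis by (simp add: q add.commute)
  qed
  show ?thesis
    using ordered[of s t] swap_rows[OF ordered[of t s]] by (cases "s \<le> t") auto
qed

text \<open>After a column swap, the minimum of the first row is in the first column. The two cases are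
  then whether the minimum of the second row is in the other column or in the same one.\<close>

lemma mat2_mem: "mat2 a b c d \<in> H"
proof -
  have ordered: "mat2 a b c d \<in> H" if ab: "a \<le> b" for a b c d
  proof -
    obtain s where b: "b = a + s" using ab le_iff_add by blast
    show ?thesis
    proof (cases "c \<le> d")
      case True
      then obtain t where "d = c + t" using le_iff_add by blast
      with scale_rows[OF zero_column_mem[of s t], of a c] b show ?thesis by simp
    next
      case False
      then have "d \<le> c" by simp
      then obtain t where "c = d + t" using le_iff_add by blast
      with scale_rows[OF zero_diagonal_mem[of s t], of a d] b show ?thesis by simp
    qed
  qed
  show ?thesis
    using ordered[of a b c d] swap_columns[OF ordered[of b a d c]] by (cases "a \<le> b") auto
qed

end

theorem theorem1p1:
  shows "generated_by M2 (range matA \<union> {matB, matC})"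
proof -
  have "X \<in> H" if "submonoid H M2" "range matA \<union> {matB, matC} \<subseteq> H" for X H
    using mat2_mem[OF that] by (cases X rule: mat2_exhaust) simp
  then have "generated_submonoid M2 (range matA \<union> {matB, matC}) = UNIV"
    unfolding generated_submonoid_def hull_def by blast
  then show ?thesis by (simp add: generated_by_def M2_def)
qed

end
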